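(* Let $X$ be a Banach space and let $T\in L(X)$ be such that $T^{\dagger}$ exists. The following statements are equivalent: (i) $T$ is an EP operator; (ii) $N(T)=N(T^{\dagger})$; (iii) $R(T)=R(T^{\dagger})$; (iv) there exists an invertible operator $P\in L(X)$ such that $T^{\dagger}=PT$.
   Context: Scalars are complex. For a Banach space $X$, $L(X)$ is the Banach algebra of bounded linear operators on $X$ with the operator norm; $N(T)$ and $R(T)$ are the null space and range of $T$. An operator $H\in L(X)$ is hermitian if $\|\exp(itH)\|=1$ for all $t\in\mathbb{R}$. The Moore-Penrose inverse of $T\in L(X)$, denoted $T^{\dagger}$, is the (at most one) $S\in L(X)$ with $T=TST$, $S=STS$, and $TS$ and $ST$ hermitian. An operator $T$ is EP if $T^{\dagger}$ exists and $TT^{\dagger}=T^{\dagger}T$. *)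

theory Defs
  imports "HOL-Analysis.Analysis"
begin

text \<open>
  Complex Banach spaces: the library's real Banach spaces, equipped with a complex scalar
  multiplication that extends the real one and is compatible with the norm.
\<close>

class scaleC = scaleR +
  fixes scaleC :: "complex \<Rightarrow> 'a \<Rightarrow> 'a"  (infixr \<open>*\<^sub>C\<close> 75)
  assumes scaleR_scaleC: "scaleR r x = scaleC (complex_of_real r) x"

class complex_normed_vector = real_normed_vector + scaleC +
  assumes scaleC_add_right: "scaleC a (x + y) = scaleC a x + scaleC a y"
    and scaleC_add_left: "scaleC (a + b) x = scaleC a x + scaleC b x"
    and scaleC_scaleC: "scaleC a (scaleC b x) = scaleC (a * b) x"
    and norm_scaleC: "norm (scaleC a x) = cmod a * norm x"

class complex_banach = complex_normed_vector + banach

instantiation complex :: complex_banach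
begin

definition scaleC_complex :: "complex \<Rightarrow> complex \<Rightarrow> complex"
  where "scaleC_complex a x = a * x"

instance
  by standard (simp_all add: scaleC_complex_def scaleR_conv_of_real algebra_simps norm_mult)

end

lemma scaleC_one: "scaleC 1 x = (x :: 'a::complex_normed_vector)"
  using scaleR_scaleC[of 1 x] by simp

instantiation blinfun :: (real_normed_vector, complex_normed_vector) scaleC
begin

lift_definition scaleC_blinfun ::
    "complex \<Rightarrow> ('a \<Rightarrow>\<^sub>L 'b) \<Rightarrow> ('a \<Rightarrow>\<^sub>L 'b)"
  is "\<lambda>c f x. scaleC c (f x)"
proof -
  fix c :: complex and f :: "'a \<Rightarrow> 'b"
  assume f: "bounded_linear f"
  have "bounded_linear (scaleC c :: 'b \<Rightarrow> 'b)"
    by (rule bounded_linear_intro[where K = "cmod c"])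
      (simp_all add: scaleC_add_right scaleR_scaleC scaleC_scaleC norm_scaleC mult.commute)
  then show "bounded_linear (\<lambda>x. scaleC c (f x))"
    using f by (rule bounded_linear_compose)
qed

instance
  by standard (transfer, simp add: scaleR_scaleC)

end

text \<open>
  \<open>L(X)\<close> is the set of complex-linear elements of the type of real-linear bounded operators.
  The norm of an operator is the same over both scalar fields, so the norm on that type
  restricts to the operator norm of \<open>L(X)\<close>. The product is \<open>o\<^sub>L\<close>, the unit \<open>id_blinfun\<close>.
\<close>

definition complex_operators :: "('a::complex_normed_vector \<Rightarrow>\<^sub>L 'a) set"
  where "complex_operators =
    {T. \<forall>c x. blinfun_apply T (c *\<^sub>C x) = c *\<^sub>C blinfun_apply T x}"

definition null_space :: "('a::complex_normed_vector \<Rightarrow>\<^sub>L 'a) \<Rightarrow> 'a set"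
  where "null_space T = {x. blinfun_apply T x = 0}"

definition range_space :: "('a::complex_normed_vector \<Rightarrow>\<^sub>L 'a) \<Rightarrow> 'a set"
  where "range_space T = range (blinfun_apply T)"

definition invertible_operator :: "('a::complex_normed_vector \<Rightarrow>\<^sub>L 'a) \<Rightarrow> bool"
  where "invertible_operator P \<longleftrightarrow> P \<in> complex_operators \<and>
    (\<exists>Q \<in> complex_operators. P o\<^sub>L Q = id_blinfun \<and> Q o\<^sub>L P = id_blinfun)"

definition power_blinfun :: "('a::real_normed_vector \<Rightarrow>\<^sub>L 'a) \<Rightarrow> nat \<Rightarrow> ('a \<Rightarrow>\<^sub>L 'a)"
  where "power_blinfun A n = (((o\<^sub>L) A) ^^ n) id_blinfun"

text \<open>
  The library's \<open>exp\<close> needs the class of unital normed algebras with \<open>norm 1 = 1\<close>, which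
  operators on the zero space violate; hence the exponential series is written out.
\<close>

definition exp_blinfun :: "('a::banach \<Rightarrow>\<^sub>L 'a) \<Rightarrow> ('a \<Rightarrow>\<^sub>L 'a)"
  where "exp_blinfun A = (\<Sum>n. power_blinfun A n /\<^sub>R fact n)"

lemma norm_power_blinfun_le: "norm (power_blinfun A n) \<le> norm A ^ n"
proof (induction n)
  case 0
  show ?case by (simp add: power_blinfun_def norm_blinfun_id_le)
next
  case (Suc n)
  have "norm (power_blinfun A (Suc n)) \<le> norm A * norm (power_blinfun A n)"
    by (simp add: power_blinfun_def norm_blinfun_compose)
  also have "\<dots> \<le> norm A * norm A ^ n"
    by (intro mult_left_mono Suc.IH norm_ge_zero)
  finally show ?case by simp
qed

lemma summable_exp_blinfun:
  fixes A :: "'a::banach \<Rightarrow>\<^sub>L 'a"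
  shows "summable (\<lambda>n. power_blinfun A n /\<^sub>R fact n)"
proof (rule summable_comparison_test)
  show "\<exists>N. \<forall>n\<ge>N. norm (power_blinfun A n /\<^sub>R fact n) \<le> norm A ^ n /\<^sub>R fact n"
    using norm_power_blinfun_le[of A] by (auto simp: divide_simps)
  show "summable (\<lambda>n. norm A ^ n /\<^sub>R fact n)"
    by (rule summable_exp_generic)
qed

definition hermitian :: "('a::complex_banach \<Rightarrow>\<^sub>L 'a) \<Rightarrow> bool"
  where "hermitian H \<longleftrightarrow> H \<in> complex_operators \<and>
    (\<forall>t::real. norm (exp_blinfun ((\<i> * complex_of_real t) *\<^sub>C H)) = 1)"

definition is_moore_penrose ::
    "('a::complex_banach \<Rightarrow>\<^sub>L 'a) \<Rightarrow> ('a \<Rightarrow>\<^sub>L 'a) \<Rightarrow> bool"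
  where "is_moore_penrose T S \<longleftrightarrow> S \<in> complex_operators \<and>
    T = T o\<^sub>L S o\<^sub>L T \<and> S = S o\<^sub>L T o\<^sub>L S \<and>
    hermitian (T o\<^sub>L S) \<and> hermitian (S o\<^sub>L T)"

definition has_moore_penrose :: "('a::complex_banach \<Rightarrow>\<^sub>L 'a) \<Rightarrow> bool"
  where "has_moore_penrose T \<longleftrightarrow> (\<exists>S. is_moore_penrose T S)"

definition moore_penrose :: "('a::complex_banach \<Rightarrow>\<^sub>L 'a) \<Rightarrow> ('a \<Rightarrow>\<^sub>L 'a)"
  where "moore_penrose T = (THE S. is_moore_penrose T S)"

definition EP_operator :: "('a::complex_banach \<Rightarrow>\<^sub>L 'a) \<Rightarrow> bool"
  where "EP_operator T \<longleftrightarrow> has_moore_penrose T \<and>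
    T o\<^sub>L moore_penrose T = moore_penrose T o\<^sub>L T"

end

theory Submission
  imports Defs
begin

text \<open>
  The engine is that a hermitian idempotent is determined by its range, and also by its null space.
  If \<open>E\<close> is a hermitian idempotent, then \<open>exp (i \<pi> E) = 1 - 2 E\<close> is a contraction.
  If \<open>E\<close> and \<open>F\<close> have the same range, then \<open>E F = F\<close> and \<open>F E = E\<close>, so
  \<open>(1 - 2 E) (1 - 2 F) = 1 + 2 (F - E)\<close> is a contraction with \<open>(F - E)\<^sup>2 = 0\<close>; its powers
  \<open>1 + 2 n (F - E)\<close> stay bounded, which forces \<open>E = F\<close>. Equal null spaces are similar.

  Applied to \<open>T S\<close>, which has the range of \<open>T\<close> and the null space of \<open>S = T\<^sup>\<dagger>\<close>, and to
  \<open>S T\<close>, where the roles are exchanged, this gives uniqueness of \<open>T\<^sup>\<dagger>\<close> and the implications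
  from (ii) and (iii) to (i). For (iv), the operator \<open>P = S\<^sup>2 + (1 - S T)\<close> has
  inverse \<open>T\<^sup>2 + (1 - S T)\<close> when \<open>S T = T S\<close>.
\<close>

section \<open>Square-zero perturbations of the identity\<close>

lemma blinfun_apply_compose_eq:
  "A o\<^sub>L B = C \<Longrightarrow> blinfun_apply A (blinfun_apply B x) = blinfun_apply C x"
  by auto

lemma nilpotent_eq_0_if_norm_id_plus_le_1:
  fixes D :: "'a::real_normed_vector \<Rightarrow>\<^sub>L 'a"
  assumes D: "D o\<^sub>L D = 0" and le: "norm (id_blinfun + D) \<le> 1"
  shows "D = 0"
proof (rule ccontr)
  assume "D \<noteq> 0"
  have pow: "power_blinfun (id_blinfun + D) n = id_blinfun + real n *\<^sub>R D" for n
  proof (induction n)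
    case 0
    show ?case by (simp add: power_blinfun_def)
  next
    case (Suc n)
    have "power_blinfun (id_blinfun + D) (Suc n)
        = (id_blinfun + D) o\<^sub>L (id_blinfun + real n *\<^sub>R D)"
      using Suc by (simp add: power_blinfun_def)
    also have "\<dots> = id_blinfun + real (Suc n) *\<^sub>R D"
      by (rule blinfun_eqI)
        (simp add: blinfun.bilinear_simps blinfun_apply_compose_eq[OF D] algebra_simps)
    finally show ?case .
  qed
  \<comment> \<open>The threshold 2 is the sum of the bounds 1 for the \<open>n\<close>-th power and
    1 for the identity.\<close>
  obtain n :: nat where n: "2 < real n * norm D"
    using reals_Archimedean3[of "norm D"] \<open>D \<noteq> 0\<close> by auto
  have "real n * norm D = norm ((id_blinfun + real n *\<^sub>R D) - id_blinfun)"
    by simp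
  also have "\<dots> \<le> norm (id_blinfun + real n *\<^sub>R D) + norm (id_blinfun :: 'a \<Rightarrow>\<^sub>L 'a)"
    by (rule norm_triangle_ineq4)
  also have "\<dots> \<le> 1 + 1"
    using norm_power_blinfun_le[of "id_blinfun + D" n] power_le_one[OF norm_ge_zero le, of n]
    by (intro add_mono norm_blinfun_id_le) (simp add: pow)
  finally show False using n by simp
qed

section \<open>Exponentials of scaled idempotents\<close>

lemma scaleC_zero_right: "c *\<^sub>C (0 :: 'a::complex_normed_vector) = 0"
  using norm_scaleC[of c 0] by simp

lemma bounded_linear_scaleC_left:
  "bounded_linear (\<lambda>c. c *\<^sub>C (x :: 'a::complex_normed_vector))"
  by (rule bounded_linear_intro[where K = "norm x"])
    (simp_all add: scaleC_add_left scaleR_scaleC scaleC_scaleC norm_scaleC scaleC_complex_def)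

text \<open>On the range of \<open>E\<close> the exponent acts as the scalar \<open>c\<close>, and
  on the null space as 0, so the exponential acts as \<open>exp c\<close> and 1
  respectively.\<close>

lemma exp_blinfun_scaleC_idempotent:
  fixes E :: "'a::complex_banach \<Rightarrow>\<^sub>L 'a"
  assumes lin: "E \<in> complex_operators" and idem: "E o\<^sub>L E = E"
  shows "blinfun_apply (exp_blinfun (c *\<^sub>C E)) x = x + (exp c - 1) *\<^sub>C blinfun_apply E x"
proof -
  have E: "E (a *\<^sub>C y) = a *\<^sub>C E y" for a y
    using lin by (simp add: complex_operators_def)
  \<comment> \<open>The zeroth power is the identity rather than \<open>E\<close>, so the component
    \<open>x - E x\<close> enters only at \<open>n = 0\<close>.\<close>
  have pow: "power_blinfun (c *\<^sub>C E) n x = (if n = 0 then x - E x else 0) + c ^ n *\<^sub>C E x" for n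
  proof (induction n)
    case 0
    show ?case by (simp add: power_blinfun_def scaleC_one)
  next
    case (Suc n)
    have "power_blinfun (c *\<^sub>C E) (Suc n) x = c *\<^sub>C E (power_blinfun (c *\<^sub>C E) n x)"
      by (simp add: power_blinfun_def scaleC_blinfun.rep_eq)
    then show ?case
      by (simp add: Suc blinfun.bilinear_simps E blinfun_apply_compose_eq[OF idem]
          scaleC_scaleC scaleC_zero_right)
  qed
  have "(\<lambda>n. (power_blinfun (c *\<^sub>C E) n /\<^sub>R fact n) x) sums exp_blinfun (c *\<^sub>C E) x"
    unfolding exp_blinfun_def
    by (intro bounded_linear.sums[OF blinfun.bounded_linear_left] summable_sums
        summable_exp_blinfun)
  moreover have "(\<lambda>n. (power_blinfun (c *\<^sub>C E) n /\<^sub>R fact n) x)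
      = (\<lambda>n. (if n = 0 then x - E x else 0) + (c ^ n /\<^sub>R fact n) *\<^sub>C E x)"
    by (rule ext, simp add: blinfun.scaleR_left pow scaleR_add_right)
      (simp add: scaleR_scaleC scaleC_scaleC scaleC_complex_def)
  moreover have "(\<lambda>n. (if n = 0 then x - E x else 0) + (c ^ n /\<^sub>R fact n) *\<^sub>C E x)
      sums ((x - E x) + exp c *\<^sub>C E x)"
    by (intro sums_add sums_single[of 0 "\<lambda>_. x - E x"]
        bounded_linear.sums[OF bounded_linear_scaleC_left] exp_converges)
  ultimately have "exp_blinfun (c *\<^sub>C E) x = (x - E x) + exp c *\<^sub>C E x"
    by (metis sums_unique2)
  also have "exp c *\<^sub>C E x = (exp c - 1) *\<^sub>C E x + E x"
    using scaleC_add_left[of "exp c - 1" 1 "E x"] by (simp add: scaleC_one)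
  finally show ?thesis by simp
qed

lemma norm_reflection_hermitian_idempotent:
  fixes E :: "'a::complex_banach \<Rightarrow>\<^sub>L 'a"
  assumes "hermitian E" and "E o\<^sub>L E = E"
  shows "norm (id_blinfun - 2 *\<^sub>R E) = 1"
proof -
  \<comment> \<open>Take t = \<pi>, for which exp (i \<pi>) - 1 = -2.\<close>
  have "exp_blinfun ((\<i> * complex_of_real pi) *\<^sub>C E) = id_blinfun - 2 *\<^sub>R E"
  proof (rule blinfun_eqI)
    fix x
    have "(- 2) *\<^sub>C E x = - (2 *\<^sub>R E x)"
      using scaleR_scaleC[of "- 2" "E x"] by simp
    then show "exp_blinfun ((\<i> * complex_of_real pi) *\<^sub>C E) x = (id_blinfun - 2 *\<^sub>R E) x"
      using assms
      by (simp add: hermitian_def exp_blinfun_scaleC_idempotent blinfun.bilinear_simps)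
  qed
  then show ?thesis
    using assms unfolding hermitian_def by metis
qed

section \<open>Hermitian idempotents with equal range or equal null space\<close>

lemma norm_reflection_compose_le_1:
  fixes E F :: "'a::complex_banach \<Rightarrow>\<^sub>L 'a"
  assumes "hermitian E" "E o\<^sub>L E = E" "hermitian F" "F o\<^sub>L F = F"
  shows "norm ((id_blinfun - 2 *\<^sub>R E) o\<^sub>L (id_blinfun - 2 *\<^sub>R F)) \<le> 1"
  using norm_blinfun_compose[of "id_blinfun - 2 *\<^sub>R E" "id_blinfun - 2 *\<^sub>R F"]
  by (simp add: norm_reflection_hermitian_idempotent assms)

lemma hermitian_idempotent_eqI_range:
  fixes E F :: "'a::complex_banach \<Rightarrow>\<^sub>L 'a"
  assumes E: "hermitian E" "E o\<^sub>L E = E" and F: "hermitian F" "F o\<^sub>L F = F"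
    and ran: "range_space E = range_space F"
  shows "E = F"
proof -
  \<comment> \<open>An idempotent fixes its range pointwise, and \<open>B x\<close> lies in the
    range of \<open>A\<close>.\<close>
  have *: "A (B x) = B x" if "A o\<^sub>L A = A" "range_space A = range_space B"
    for A B :: "'a \<Rightarrow>\<^sub>L 'a" and x
  proof -
    have "B x \<in> range A"
      using that(2) by (auto simp: range_space_def)
    then show ?thesis
      using blinfun_apply_compose_eq[OF that(1)] by auto
  qed
  note simps = blinfun.bilinear_simps *[OF E(2) ran] *[OF F(2) ran[symmetric]]
    blinfun_apply_compose_eq[OF E(2)] blinfun_apply_compose_eq[OF F(2)]
  have "2 *\<^sub>R (F - E) = 0"
  proof (rule nilpotent_eq_0_if_norm_id_plus_le_1)
    show "2 *\<^sub>R (F - E) o\<^sub>L 2 *\<^sub>R (F - E) = 0"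
      by (rule blinfun_eqI) (simp add: simps)
    \<comment> \<open>The product contributes 4 E F = 4 F, which turns -2 F into +2 F.\<close>
    have "(id_blinfun - 2 *\<^sub>R E) o\<^sub>L (id_blinfun - 2 *\<^sub>R F) = id_blinfun + 2 *\<^sub>R (F - E)"
      by (rule blinfun_eqI) (simp add: simps algebra_simps flip: scaleR_2)
    then show "norm (id_blinfun + 2 *\<^sub>R (F - E)) \<le> 1"
      using norm_reflection_compose_le_1[OF E F] by simp
  qed
  then show ?thesis by simp
qed

lemma hermitian_idempotent_eqI_null:
  fixes E F :: "'a::complex_banach \<Rightarrow>\<^sub>L 'a"
  assumes E: "hermitian E" "E o\<^sub>L E = E" and F: "hermitian F" "F o\<^sub>L F = F"
    and null: "null_space E = null_space F"
  shows "E = F"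
proof -
  \<comment> \<open>The vector \<open>x - B x\<close> is killed by \<open>B\<close>, hence by
    \<open>A\<close>.\<close>
  have *: "A (B x) = A x" if "B o\<^sub>L B = B" "null_space A = null_space B"
    for A B :: "'a \<Rightarrow>\<^sub>L 'a" and x
  proof -
    have "x - B x \<in> null_space A"
      unfolding that(2)
      by (simp add: null_space_def blinfun.bilinear_simps blinfun_apply_compose_eq[OF that(1)])
    then show ?thesis
      by (simp add: null_space_def blinfun.bilinear_simps)
  qed
  note simps = blinfun.bilinear_simps *[OF F(2) null] *[OF E(2) null[symmetric]]
    blinfun_apply_compose_eq[OF E(2)] blinfun_apply_compose_eq[OF F(2)]
  have "2 *\<^sub>R (E - F) = 0"
  proof (rule nilpotent_eq_0_if_norm_id_plus_le_1)
    show "2 *\<^sub>R (E - F) o\<^sub>L 2 *\<^sub>R (E - F) = 0"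
      by (rule blinfun_eqI) (simp add: simps)
    \<comment> \<open>Here 4 E F = 4 E, so the difference appears with the opposite sign.\<close>
    have "(id_blinfun - 2 *\<^sub>R E) o\<^sub>L (id_blinfun - 2 *\<^sub>R F) = id_blinfun + 2 *\<^sub>R (E - F)"
      by (rule blinfun_eqI) (simp add: simps algebra_simps flip: scaleR_2)
    then show "norm (id_blinfun + 2 *\<^sub>R (E - F)) \<le> 1"
      using norm_reflection_compose_le_1[OF E F] by simp
  qed
  then show ?thesis by simp
qed

section \<open>Moore-Penrose inverses: projections and uniqueness\<close>

lemma is_moore_penrose_apply:
  assumes "is_moore_penrose T S"
  shows "T (S (T x)) = T x" "S (T (S x)) = S x"
  using assms unfolding is_moore_penrose_def by (metis blinfun_apply_blinfun_compose)+

lemma is_moore_penrose_idempotent: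
  assumes "is_moore_penrose T S"
  shows "(T o\<^sub>L S) o\<^sub>L (T o\<^sub>L S) = T o\<^sub>L S" "(S o\<^sub>L T) o\<^sub>L (S o\<^sub>L T) = S o\<^sub>L T"
  by (auto intro!: blinfun_eqI simp: is_moore_penrose_apply[OF assms])

text \<open>For each equality one inclusion holds for any composition; the other comes from T = T S
  T or S = S T S.\<close>

lemma is_moore_penrose_spaces:
  assumes "is_moore_penrose T S"
  shows "range_space (T o\<^sub>L S) = range_space T" "range_space (S o\<^sub>L T) = range_space S"
    and "null_space (T o\<^sub>L S) = null_space S" "null_space (S o\<^sub>L T) = null_space T"
proof -
  note a = is_moore_penrose_apply[OF assms]
  show "range_space (T o\<^sub>L S) = range_space T" "range_space (S o\<^sub>L T) = range_space S"
    unfolding range_space_def by (auto simp: image_iff) (metis a)+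
  show "null_space (T o\<^sub>L S) = null_space S" "null_space (S o\<^sub>L T) = null_space T"
    unfolding null_space_def by auto (metis a blinfun.zero_right)+
qed

lemma is_moore_penrose_unique:
  assumes S: "is_moore_penrose T S" and S': "is_moore_penrose T S'"
  shows "S = S'"
proof -
  have herm: "hermitian (T o\<^sub>L S)" "hermitian (S o\<^sub>L T)"
    "hermitian (T o\<^sub>L S')" "hermitian (S' o\<^sub>L T)"
    using S S' unfolding is_moore_penrose_def by blast+
  note idem = is_moore_penrose_idempotent[OF S] is_moore_penrose_idempotent[OF S']
  note spaces = is_moore_penrose_spaces[OF S] is_moore_penrose_spaces[OF S']
  have TS: "T o\<^sub>L S = T o\<^sub>L S'"
    by (rule hermitian_idempotent_eqI_range[OF herm(1) idem(1) herm(3) idem(3)])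
      (simp only: spaces)
  have ST: "S o\<^sub>L T = S' o\<^sub>L T"
    by (rule hermitian_idempotent_eqI_null[OF herm(2) idem(2) herm(4) idem(4)])
      (simp only: spaces)
  show ?thesis
  proof (rule blinfun_eqI)
    fix x
    have "S x = S (T (S x))"
      by (simp only: is_moore_penrose_apply(2)[OF S])
    \<comment> \<open>First \<open>S T\<close> becomes \<open>S' T\<close>, then \<open>T S\<close>
      becomes \<open>T S'\<close>.\<close>
    also have "\<dots> = S' (T (S' x))"
      using TS ST by (metis blinfun_apply_blinfun_compose)
    also have "\<dots> = S' x"
      by (simp only: is_moore_penrose_apply(2)[OF S'])
    finally show "S x = S' x" .
  qed
qed

text \<open>Uniqueness makes the definite description in \<open>moore_penrose\<close>
  denote.\<close>

lemma is_moore_penrose_moore_penrose: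
  assumes "has_moore_penrose T"
  shows "is_moore_penrose T (moore_penrose T)"
  using assms unfolding has_moore_penrose_def moore_penrose_def
  by (metis is_moore_penrose_unique theI)

section \<open>The invertible factor and the equivalences\<close>

lemma complex_operators_intros:
  fixes A B :: "'a::complex_normed_vector \<Rightarrow>\<^sub>L 'a"
  shows "(id_blinfun :: 'a \<Rightarrow>\<^sub>L 'a) \<in> complex_operators"
    and "A \<in> complex_operators \<Longrightarrow> B \<in> complex_operators \<Longrightarrow> A + B \<in> complex_operators"
    and "A \<in> complex_operators \<Longrightarrow> B \<in> complex_operators \<Longrightarrow> A - B \<in> complex_operators"
    and "A \<in> complex_operators \<Longrightarrow> B \<in> complex_operators \<Longrightarrow> A o\<^sub>L B \<in> complex_operators"
proof -
  have "c *\<^sub>C (x - y) = c *\<^sub>C x - c *\<^sub>C y" for c and x y :: 'a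
    using scaleC_add_right[of c "x - y" y] by (simp add: algebra_simps)
  then show "A \<in> complex_operators \<Longrightarrow> B \<in> complex_operators \<Longrightarrow> A - B \<in> complex_operators"
    by (simp add: complex_operators_def blinfun.bilinear_simps)
qed (simp_all add: complex_operators_def blinfun.bilinear_simps scaleC_add_right)

lemma commuting_moore_penrose_imp_invertible_factor:
  assumes T: "T \<in> complex_operators" and S: "is_moore_penrose T S"
    and comm: "T o\<^sub>L S = S o\<^sub>L T"
  shows "\<exists>P \<in> complex_operators. invertible_operator P \<and> S = P o\<^sub>L T"
proof -
  \<comment> \<open>On the range of \<open>S T\<close> the operators \<open>S\<close> and
    \<open>T\<close> invert each other, hence so do their squares; the summand 1 - S T makes
    \<open>P\<close> and \<open>Q\<close> the identity on the null space of
    \<open>S T\<close>.\<close>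
  define P where "P = (S o\<^sub>L S) + (id_blinfun - (S o\<^sub>L T))"
  define Q where "Q = (T o\<^sub>L T) + (id_blinfun - (S o\<^sub>L T))"
  have "S \<in> complex_operators"
    using S by (simp add: is_moore_penrose_def)
  then have PQ: "P \<in> complex_operators" "Q \<in> complex_operators"
    unfolding P_def Q_def by (intro complex_operators_intros T; simp)+
  have TS: "T (S x) = S (T x)" for x
    using comm by (metis blinfun_apply_blinfun_compose)
  \<comment> \<open>With \<open>S\<close> moved outward, the cancellation rules become S T T = T and
    S S T = S.\<close>
  note a = is_moore_penrose_apply[OF S, unfolded TS]
  have "P o\<^sub>L Q = id_blinfun" "Q o\<^sub>L P = id_blinfun"
    unfolding P_def Q_def
    by (auto intro!: blinfun_eqI simp: blinfun.bilinear_simps TS a)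
  \<comment> \<open>S S T = S, while 1 - S T annihilates the range of \<open>T\<close> because S T T
    = T.\<close>
  moreover have "S = P o\<^sub>L T"
    unfolding P_def by (auto intro!: blinfun_eqI simp: blinfun.bilinear_simps TS a)
  ultimately show ?thesis
    using PQ unfolding invertible_operator_def by blast
qed

lemma null_space_invertible_compose:
  assumes "invertible_operator P"
  shows "null_space (P o\<^sub>L T) = null_space T"
proof -
  obtain Q where "Q o\<^sub>L P = id_blinfun"
    using assms unfolding invertible_operator_def by blast
  then have "P y = 0 \<longleftrightarrow> y = 0" for y
    by (metis blinfun.zero_right blinfun_apply_blinfun_compose blinfun_apply_id_blinfun id_apply)
  then show ?thesis
    by (simp add: null_space_def)
qed

theorem theorem16:
  fixes T :: "'a::complex_banach \<Rightarrow>\<^sub>L 'a"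
  assumes "T \<in> complex_operators"
    and "has_moore_penrose T"
  shows "(EP_operator T \<longleftrightarrow> null_space T = null_space (moore_penrose T)) \<and>
    (EP_operator T \<longleftrightarrow> range_space T = range_space (moore_penrose T)) \<and>
    (EP_operator T \<longleftrightarrow>
      (\<exists>P \<in> complex_operators. invertible_operator P \<and> moore_penrose T = P o\<^sub>L T))"
proof -
  define S where "S = moore_penrose T"
  have S: "is_moore_penrose T S"
    unfolding S_def using assms(2) by (rule is_moore_penrose_moore_penrose)
  note spaces = is_moore_penrose_spaces[OF S]
  note idem = is_moore_penrose_idempotent[OF S]
  have herm: "hermitian (T o\<^sub>L S)" "hermitian (S o\<^sub>L T)"
    using S by (simp_all add: is_moore_penrose_def)
  have EP: "EP_operator T \<longleftrightarrow> T o\<^sub>L S = S o\<^sub>L T"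
    using assms(2) by (simp add: EP_operator_def S_def)
  have null: "T o\<^sub>L S = S o\<^sub>L T \<longleftrightarrow> null_space T = null_space S"
    using hermitian_idempotent_eqI_null[OF herm(1) idem(1) herm(2) idem(2)] spaces by metis
  have ran: "T o\<^sub>L S = S o\<^sub>L T \<longleftrightarrow> range_space T = range_space S"
    using hermitian_idempotent_eqI_range[OF herm(1) idem(1) herm(2) idem(2)] spaces by metis
  \<comment> \<open>The converse goes through null spaces: an invertible left factor is injective,
    so \<open>S\<close> and \<open>T\<close> have the same null space and \<open>null\<close>
    applies.\<close>
  have "T o\<^sub>L S = S o\<^sub>L T \<longleftrightarrow> (\<exists>P \<in> complex_operators. invertible_operator P \<and> S = P o\<^sub>L T)"
    using commuting_moore_penrose_imp_invertible_factor[OF assms(1) S]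
      null null_space_invertible_compose by metis
  with null ran show ?thesis
    unfolding EP S_def[symmetric] by blast
qed

end
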